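(* Let $\alpha,\beta\geq 0$ be real numbers with $\alpha+\beta\neq 0$, and let $a<b$ be real numbers with $b\in\{a+k\alpha: k\in\mathbb{N}_0\}$ and $a\in\{b-k\beta: k\in\mathbb{N}_0\}$. Let $f,g:\mathbb{R}\to\mathbb{R}$ be bounded and $\alpha,\beta$-symmetric integrable on $[a,b]$, with $g$ nonnegative. Let $m$ and $M$ be the infimum and the supremum, respectively, of the function $f$. Then there exists a real number $K$ with $m\leq K\leq M$ such that $$\int_a^b f(t)g(t)\,d_{\alpha,\beta}t=K\int_a^b g(t)\,d_{\alpha,\beta}t.$$
   Context: $\mathbb{N}_0=\{0,1,2,\dots\}$. Let $h:\mathbb{R}\to\mathbb{R}$ and $a<b$ be reals. For $\alpha>0$, $h$ is $\alpha$-forward integrable on $[a,b]$ if the series $\int_x^{+\infty}h(t)\Delta_\alpha t:=\alpha\sum_{k=0}^{+\infty}h(x+k\alpha)$ converges for $x=a$ and $x=b$; then $\int_a^b h(t)\Delta_\alpha t:=\int_a^{+\infty}h(t)\Delta_\alpha t-\int_b^{+\infty}h(t)\Delta_\alpha t$. For $\beta>0$, $h$ is $\beta$-backward integrable on $[a,b]$ if the series $\int_{-\infty}^x h(t)\nabla_\beta t:=\beta\sum_{k=0}^{+\infty}h(x-k\beta)$ converges for $x=a$ and $x=b$; then $\int_a^b h(t)\nabla_\beta t:=\int_{-\infty}^b h(t)\nabla_\beta t-\int_{-\infty}^a h(t)\nabla_\beta t$. For $\alpha,\beta\ge 0$ with $\alpha+\beta>0$, $h$ is $\alpha,\beta$-symmetric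 integrable on $[a,b]$ if it is $\alpha$-forward integrable and $\beta$-backward integrable on $[a,b]$ (the forward requirement is dropped if $\alpha=0$, and the backward requirement is dropped if $\beta=0$); then $$\int_a^b h(t)\,d_{\alpha,\beta}t:=\frac{\alpha}{\alpha+\beta}\int_a^b h(t)\Delta_\alpha t+\frac{\beta}{\alpha+\beta}\int_a^b h(t)\nabla_\beta t,$$ where a term with zero coefficient is omitted. The infimum and supremum of $f$ are taken over its whole domain $\mathbb{R}$. *)

theory Defs
  imports "HOL-Analysis.Analysis"
begin

definition forward_improper :: "real \<Rightarrow> (real \<Rightarrow> real) \<Rightarrow> real \<Rightarrow> real" where
  "forward_improper \<alpha> h x = \<alpha> * (\<Sum>k. h (x + real k * \<alpha>))"

definition forward_integrable :: "real \<Rightarrow> (real \<Rightarrow> real) \<Rightarrow> real \<Rightarrow> real \<Rightarrow> bool" where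
  "forward_integrable \<alpha> h a b \<longleftrightarrow>
     summable (\<lambda>k. h (a + real k * \<alpha>)) \<and> summable (\<lambda>k. h (b + real k * \<alpha>))"

definition forward_integral :: "real \<Rightarrow> (real \<Rightarrow> real) \<Rightarrow> real \<Rightarrow> real \<Rightarrow> real" where
  "forward_integral \<alpha> h a b = forward_improper \<alpha> h a - forward_improper \<alpha> h b"

definition backward_improper :: "real \<Rightarrow> (real \<Rightarrow> real) \<Rightarrow> real \<Rightarrow> real" where
  "backward_improper \<beta> h x = \<beta> * (\<Sum>k. h (x - real k * \<beta>))"

definition backward_integrable :: "real \<Rightarrow> (real \<Rightarrow> real) \<Rightarrow> real \<Rightarrow> real \<Rightarrow> bool" where
  "backward_integrable \<beta> h a b \<longleftrightarrow>
     summable (\<lambda>k. h (a - real k * \<beta>)) \<and> summable (\<lambda>k. h (b - real k * \<beta>))"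

definition backward_integral :: "real \<Rightarrow> (real \<Rightarrow> real) \<Rightarrow> real \<Rightarrow> real \<Rightarrow> real" where
  "backward_integral \<beta> h a b = backward_improper \<beta> h b - backward_improper \<beta> h a"

text \<open>The two notions below are meant for nonnegative steps, not both zero. A zero step imposes
  no integrability condition, and its term vanishes because its coefficient is zero.\<close>

definition symmetric_integrable ::
  "real \<Rightarrow> real \<Rightarrow> (real \<Rightarrow> real) \<Rightarrow> real \<Rightarrow> real \<Rightarrow> bool" where
  "symmetric_integrable \<alpha> \<beta> h a b \<longleftrightarrow>
     (\<alpha> \<noteq> 0 \<longrightarrow> forward_integrable \<alpha> h a b) \<and> (\<beta> \<noteq> 0 \<longrightarrow> backward_integrable \<beta> h a b)"

definition symmetric_integral ::
  "real \<Rightarrow> real \<Rightarrow> (real \<Rightarrow> real) \<Rightarrow> real \<Rightarrow> real \<Rightarrow> real" where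
  "symmetric_integral \<alpha> \<beta> h a b =
     \<alpha> / (\<alpha> + \<beta>) * forward_integral \<alpha> h a b + \<beta> / (\<alpha> + \<beta>) * backward_integral \<beta> h a b"

end

theory Submission
  imports Defs
begin

text \<open>
  The endpoints differ by a whole number of steps in either direction, so the two tails in each
  improper integral cancel: \<open>forward_integral_eq_sum\<close> and \<open>backward_integral_eq_sum\<close> turn the
  symmetric integral into a finite sum with nonnegative weights. It is therefore a monotone
  functional that commutes with scalars. Integrating the pointwise bounds
  \<open>inf f * g t \<le> f t * g t \<le> sup f * g t\<close> squeezes the integral of the product between the
  extremal multiples of the integral of \<open>g\<close>, and \<open>K\<close> is the quotient of the two integrals. If the
  integral of \<open>g\<close> is zero, the same bounds force the integral of the product to vanish.

  Cancelling the tails needs the product to be integrable. Nonnegativity of \<open>g\<close> makes its series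
  absolutely convergent, so multiplication by the bounded function \<open>f\<close> preserves convergence
  (\<open>symmetric_integrable_bounded_mult\<close>).
\<close>

text \<open>The backward notions are the forward ones seen through \<open>t \<mapsto> - t\<close>, which exchanges the roles
  of the endpoints.\<close>

lemma backward_integrable_reflect:
  "backward_integrable \<beta> h a b \<longleftrightarrow> forward_integrable \<beta> (\<lambda>t. h (- t)) (- b) (- a)"
  by (auto simp: backward_integrable_def forward_integrable_def)

lemma backward_integral_reflect:
  "backward_integral \<beta> h a b = forward_integral \<beta> (\<lambda>t. h (- t)) (- b) (- a)"
  by (simp add: backward_integral_def forward_integral_def
      backward_improper_def forward_improper_def)

lemma forward_integral_eq_sum:
  assumes "forward_integrable \<alpha> h a b" and "b = a + real n * \<alpha>"
  shows "forward_integral \<alpha> h a b = \<alpha> * (\<Sum>k<n. h (a + real k * \<alpha>))"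
proof -
  have "(\<Sum>k. h (b + real k * \<alpha>)) = (\<Sum>k. h (a + real (k + n) * \<alpha>))"
    using assms(2) by (simp add: algebra_simps)
  also have "\<dots> = (\<Sum>k. h (a + real k * \<alpha>)) - (\<Sum>k<n. h (a + real k * \<alpha>))"
    using assms(1) by (intro suminf_minus_initial_segment) (simp add: forward_integrable_def)
  finally have "(\<Sum>k<n. h (a + real k * \<alpha>)) =
      (\<Sum>k. h (a + real k * \<alpha>)) - (\<Sum>k. h (b + real k * \<alpha>))"
    by linarith
  then show ?thesis
    by (simp only: forward_integral_def forward_improper_def right_diff_distrib)
qed

lemma backward_integral_eq_sum:
  assumes "backward_integrable \<beta> h a b" and "a = b - real n * \<beta>"
  shows "backward_integral \<beta> h a b = \<beta> * (\<Sum>k<n. h (b - real k * \<beta>))"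
  using forward_integral_eq_sum[of \<beta> "\<lambda>t. h (- t)" "- b" "- a" n] assms
  by (simp add: backward_integrable_reflect backward_integral_reflect)

text \<open>A zero step gives no integrability to cancel tails with, but then the coefficient
  of that term is zero on both sides.\<close>

lemma symmetric_integral_eq_sum:
  assumes "symmetric_integrable \<alpha> \<beta> h a b" and "b = a + real p * \<alpha>" and "a = b - real q * \<beta>"
  shows "symmetric_integral \<alpha> \<beta> h a b =
    \<alpha> / (\<alpha> + \<beta>) * (\<alpha> * (\<Sum>k<p. h (a + real k * \<alpha>))) +
    \<beta> / (\<alpha> + \<beta>) * (\<beta> * (\<Sum>k<q. h (b - real k * \<beta>)))"
proof -
  have "\<alpha> / (\<alpha> + \<beta>) * forward_integral \<alpha> h a b =
      \<alpha> / (\<alpha> + \<beta>) * (\<alpha> * (\<Sum>k<p. h (a + real k * \<alpha>)))"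
    using assms(1) forward_integral_eq_sum[OF _ assms(2), of h]
    by (cases "\<alpha> = 0") (auto simp: symmetric_integrable_def)
  moreover have "\<beta> / (\<alpha> + \<beta>) * backward_integral \<beta> h a b =
      \<beta> / (\<alpha> + \<beta>) * (\<beta> * (\<Sum>k<q. h (b - real k * \<beta>)))"
    using assms(1) backward_integral_eq_sum[OF _ assms(3), of h]
    by (cases "\<beta> = 0") (auto simp: symmetric_integrable_def)
  ultimately show ?thesis
    unfolding symmetric_integral_def by (rule arg_cong2)
qed

text \<open>The conditions on the endpoints are essential: a difference of two tails taken along different
  lattices is not monotone in the integrand, since a larger integrand may grow only on the
  lattice that is subtracted.\<close>

lemma symmetric_integral_mono:
  assumes "\<alpha> \<ge> 0" and "\<beta> \<ge> 0" and "b = a + real p * \<alpha>" and "a = b - real q * \<beta>"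
    and "symmetric_integrable \<alpha> \<beta> u a b" and "symmetric_integrable \<alpha> \<beta> v a b"
    and "\<And>t. u t \<le> v t"
  shows "symmetric_integral \<alpha> \<beta> u a b \<le> symmetric_integral \<alpha> \<beta> v a b"
  unfolding symmetric_integral_eq_sum[OF assms(5,3,4)] symmetric_integral_eq_sum[OF assms(6,3,4)]
  using assms(1,2,7) by (intro add_mono mult_left_mono sum_mono) auto

lemma symmetric_integrable_cmult:
  "symmetric_integrable \<alpha> \<beta> h a b \<Longrightarrow> symmetric_integrable \<alpha> \<beta> (\<lambda>t. c * h t) a b"
  by (auto simp: symmetric_integrable_def forward_integrable_def backward_integrable_def
      intro: summable_mult)

lemma symmetric_integral_cmult:
  assumes "symmetric_integrable \<alpha> \<beta> h a b"
  shows "symmetric_integral \<alpha> \<beta> (\<lambda>t. c * h t) a b = c * symmetric_integral \<alpha> \<beta> h a b"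
proof -
  have "\<alpha> / (\<alpha> + \<beta>) * forward_integral \<alpha> (\<lambda>t. c * h t) a b =
      c * (\<alpha> / (\<alpha> + \<beta>) * forward_integral \<alpha> h a b)"
    using assms by (cases "\<alpha> = 0") (auto simp: symmetric_integrable_def forward_integrable_def
        forward_integral_def forward_improper_def suminf_mult algebra_simps)
  moreover have "\<beta> / (\<alpha> + \<beta>) * backward_integral \<beta> (\<lambda>t. c * h t) a b =
      c * (\<beta> / (\<alpha> + \<beta>) * backward_integral \<beta> h a b)"
    using assms by (cases "\<beta> = 0") (auto simp: symmetric_integrable_def backward_integrable_def
        backward_integral_def backward_improper_def suminf_mult algebra_simps)
  ultimately show ?thesis
    unfolding symmetric_integral_def by (simp only: distrib_left)
qed

lemma summable_bounded_mult:
  fixes f g :: "real \<Rightarrow> real"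
  assumes "bounded (range f)" and "\<And>t. g t \<ge> 0" and "summable (\<lambda>k. g (s k))"
  shows "summable (\<lambda>k. f (s k) * g (s k))"
proof -
  obtain C where C: "\<And>t. \<bar>f t\<bar> \<le> C"
    using assms(1) by (auto simp: bounded_iff)
  show ?thesis
  proof (rule summable_comparison_test')
    show "summable (\<lambda>k. C * g (s k))"
      using assms(3) by (rule summable_mult)
    show "norm (f (s k) * g (s k)) \<le> C * g (s k)" for k
      using C assms(2) by (simp add: abs_mult mult_right_mono)
  qed
qed

lemma symmetric_integrable_bounded_mult:
  fixes f g :: "real \<Rightarrow> real"
  assumes "bounded (range f)" and "\<And>t. g t \<ge> 0" and "symmetric_integrable \<alpha> \<beta> g a b"
  shows "symmetric_integrable \<alpha> \<beta> (\<lambda>t. f t * g t) a b"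
  using assms(3) summable_bounded_mult[of f g, OF assms(1,2)]
  by (simp add: symmetric_integrable_def forward_integrable_def backward_integrable_def)

lemma multiple_between:
  fixes I J m M :: real
  assumes "m * J \<le> I" and "I \<le> M * J" and "0 \<le> J" and "m \<le> M"
  shows "\<exists>K. m \<le> K \<and> K \<le> M \<and> I = K * J"
proof (cases "J = 0")
  case True
  then show ?thesis using assms by auto
next
  case False
  then have "m \<le> I / J \<and> I / J \<le> M \<and> I = I / J * J"
    using assms by (simp add: field_simps)
  then show ?thesis by blast
qed

theorem theorem9:
  fixes \<alpha> \<beta> a b :: real and f g :: "real \<Rightarrow> real"
  assumes "\<alpha> \<ge> 0" and "\<beta> \<ge> 0" and "\<alpha> + \<beta> \<noteq> 0"
    and "a < b"
    and "b \<in> {a + real k * \<alpha> | k :: nat. True}"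
    and "a \<in> {b - real k * \<beta> | k :: nat. True}"
    and "bounded (range f)" and "bounded (range g)"
    and "symmetric_integrable \<alpha> \<beta> f a b" and "symmetric_integrable \<alpha> \<beta> g a b"
    and "\<And>t. g t \<ge> 0"
  shows "symmetric_integrable \<alpha> \<beta> (\<lambda>t. f t * g t) a b \<and>
    (\<exists>K :: real. (INF t. f t) \<le> K \<and> K \<le> (SUP t. f t) \<and>
      symmetric_integral \<alpha> \<beta> (\<lambda>t. f t * g t) a b = K * symmetric_integral \<alpha> \<beta> g a b)"
proof
  define m where "m = (INF t. f t)"
  define M where "M = (SUP t. f t)"
  obtain p q where p: "b = a + real p * \<alpha>" and q: "a = b - real q * \<beta>"
    using assms(5,6) by blast
  have m: "m \<le> f t" for t
    unfolding m_def using assms(7) by (intro cINF_lower bounded_imp_bdd_below) auto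
  have M: "f t \<le> M" for t
    unfolding M_def using assms(7) by (intro cSUP_upper bounded_imp_bdd_above) auto
  note mono = symmetric_integral_mono[OF assms(1,2) p q]
  note cmult = symmetric_integrable_cmult[OF assms(10)] symmetric_integral_cmult[OF assms(10)]
  show fg: "symmetric_integrable \<alpha> \<beta> (\<lambda>t. f t * g t) a b"
    using assms(7,11,10) by (rule symmetric_integrable_bounded_mult)
  have "symmetric_integral \<alpha> \<beta> (\<lambda>t. m * g t) a b \<le> symmetric_integral \<alpha> \<beta> (\<lambda>t. f t * g t) a b"
    using m assms(11) by (intro mono cmult fg mult_right_mono)
  then have "m * symmetric_integral \<alpha> \<beta> g a b \<le> symmetric_integral \<alpha> \<beta> (\<lambda>t. f t * g t) a b"
    by (simp add: cmult)
  moreover have "symmetric_integral \<alpha> \<beta> (\<lambda>t. f t * g t) a b \<le> symmetric_integral \<alpha> \<beta> (\<lambda>t. M * g t) a b"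
    using M assms(11) by (intro mono cmult fg mult_right_mono)
  then have "symmetric_integral \<alpha> \<beta> (\<lambda>t. f t * g t) a b \<le> M * symmetric_integral \<alpha> \<beta> g a b"
    by (simp add: cmult)
  \<comment> \<open>Writing the zero function as \<open>0 * g\<close> gives its integral by homogeneity.\<close>
  moreover have "symmetric_integral \<alpha> \<beta> (\<lambda>t. 0 * g t) a b \<le> symmetric_integral \<alpha> \<beta> g a b"
    using assms(11) by (intro mono cmult assms(10)) simp
  then have "0 \<le> symmetric_integral \<alpha> \<beta> g a b"
    unfolding cmult(2) by simp
  moreover have "m \<le> M"
    using m M by (rule order_trans)
  ultimately show "\<exists>K :: real. (INF t. f t) \<le> K \<and> K \<le> (SUP t. f t) \<and>
      symmetric_integral \<alpha> \<beta> (\<lambda>t. f t * g t) a b = K * symmetric_integral \<alpha> \<beta> g a b"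
    unfolding m_def[symmetric] M_def[symmetric] by (intro multiple_between)
qed

end
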